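(* Given any finite Markov decision process $(\mathcal S,\mathcal A,p,r,\hat{\boldsymbol p})$ with horizon $T=1$, any policy $\boldsymbol\pi:\mathcal S\to\Delta_A$, and any $\alpha\in(0,1]$, let $\tilde s\sim\hat{\boldsymbol p}$, $\tilde a\sim\boldsymbol\pi(\tilde s)$, $\tilde s'\sim p(\tilde s,\tilde a,\cdot)$. Then $$\mathrm{EVaR}_\alpha\big[r(\tilde s,\tilde a,\tilde s')\big]=\inf_{\boldsymbol\zeta\in(0,1]^S,\ \boldsymbol\xi\in\mathcal Z'_{\mathrm E}(\boldsymbol\zeta)}\ \sum_{s\in\mathcal S}\xi_s\,\mathrm{EVaR}_{\zeta_s}\big[r(s,\tilde a,\tilde s')\mid\tilde s=s\big],$$ where $$\mathcal Z'_{\mathrm E}(\boldsymbol\zeta)=\Big\{\boldsymbol\xi\in\Delta_S\ \Big|\ \boldsymbol\xi\ll\hat{\boldsymbol p},\ \sum_{s\in\mathcal S}\xi_s\big(\log(\xi_s/\hat p_s)-\log\zeta_s\big)\le-\log\alpha\Big\}.$$ Moreover, $$\mathrm{EVaR}_\alpha\big[r(\tilde s,\tilde a,\tilde s')\big]\le\min_{\boldsymbol\xi\in\mathcal Z_{\mathrm E}}\ \sum_{s\in\mathcal S}\xi_s\,\mathrm{EVaR}_{\alpha\xi_s\hat p_s^{-1}}\big[r(s,\tilde a,\tilde s')\mid\tilde s=s\big],$$ where $$\mathcal Z_{\mathrm E}=\Big\{\boldsymbol\xi\in\Delta_S\ \Big|\ \sum_{s\in\mathcal S}\xi_s\log(\xi_s/\hat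 p_s)\le-\log\alpha,\quad\alpha\,\xi_s\le\hat p_s\ \text{for all } s\in\mathcal S\Big\}.$$
   Context: A finite MDP with horizon $T=1$ consists of a finite state set $\mathcal S$ with $S=|\mathcal S|$, a finite action set $\mathcal A$ with $A=|\mathcal A|$, a transition function $p$ where $p(s,a,\cdot)$ is a probability distribution on $\mathcal S$ for each $(s,a)$, a reward function $r:\mathcal S\times\mathcal A\times\mathcal S\to\mathbb R$, and an initial distribution $\hat{\boldsymbol p}$ on $\mathcal S$ with $\hat p_s>0$ for every $s\in\mathcal S$. $\Delta_S$ and $\Delta_A$ are the sets of probability vectors indexed by $\mathcal S$ and $\mathcal A$. A risk measure written with "$\mid\tilde s=s$" is evaluated under the conditional distribution given $\tilde s=s$. $\boldsymbol\xi\ll\hat{\boldsymbol p}$ means $\hat p_s=0\Rightarrow\xi_s=0$. For a real random variable $\tilde x$ on a finite probability space, $\mathrm{EVaR}_\alpha[\tilde x]=\sup_{\beta>0}\,-\frac1\beta\log\big(\alpha^{-1}\mathbb E[\exp(-\beta\tilde x)]\big)$ for $\alpha\in(0,1]$ (so $\mathrm{EVaR}_1[\tilde x]=\mathbb E[\tilde x]$), and $\mathrm{EVaR}_0[\tilde x]=\operatorname{ess\,inf}[\tilde x]$. The convention $0\log 0=0$ is used. *)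

theory Defs
  imports "HOL-Probability.Probability"
begin

text \<open>A finite MDP with horizon 1 is given by finite types of states and actions, transition
  probabilities \<open>p\<close>, rewards \<open>r\<close> and an initial distribution \<open>ph\<close>. Probability vectors over a
  finite index type are represented by the type \<open>pmf\<close>.\<close>

definition ess_inf :: "'w pmf \<Rightarrow> ('w \<Rightarrow> real) \<Rightarrow> real" where
  "ess_inf M X = Sup {c. AE \<omega> in measure_pmf M. c \<le> X \<omega>}"

text \<open>Only levels in \<open>[0, 1]\<close> are meaningful. For a level in \<open>(0, 1]\<close> and bounded \<open>X\<close> the supremum
  is over a set bounded above by the expectation of \<open>X\<close> (Jensen), so it is a genuine
  supremum of reals.\<close>

definition EVaR :: "real \<Rightarrow> 'w pmf \<Rightarrow> ('w \<Rightarrow> real) \<Rightarrow> real" where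
  "EVaR \<alpha> M X =
     (if \<alpha> = 0 then ess_inf M X
      else SUP \<beta>\<in>{0<..}.
        - (1 / \<beta>) * ln (inverse \<alpha> * measure_pmf.expectation M (\<lambda>\<omega>. exp (- \<beta> * X \<omega>))))"

definition trajectory_pmf ::
  "('s \<Rightarrow> 'a \<Rightarrow> 's pmf) \<Rightarrow> 's pmf \<Rightarrow> ('s \<Rightarrow> 'a pmf) \<Rightarrow> ('s \<times> 'a \<times> 's) pmf" where
  "trajectory_pmf p ph \<pi> =
     do {
       s \<leftarrow> ph;
       a \<leftarrow> \<pi> s;
       s' \<leftarrow> p s a;
       return_pmf (s, a, s')
     }"

definition reward_EVaR ::
  "('s \<Rightarrow> 'a \<Rightarrow> 's pmf) \<Rightarrow> ('s \<Rightarrow> 'a \<Rightarrow> 's \<Rightarrow> real) \<Rightarrow> 's pmf \<Rightarrow> ('s \<Rightarrow> 'a pmf) \<Rightarrow> real \<Rightarrow> real" where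
  "reward_EVaR p r ph \<pi> \<alpha> = EVaR \<alpha> (trajectory_pmf p ph \<pi>) (\<lambda>(s, a, s'). r s a s')"

definition reward_EVaR_given ::
  "('s \<Rightarrow> 'a \<Rightarrow> 's pmf) \<Rightarrow> ('s \<Rightarrow> 'a \<Rightarrow> 's \<Rightarrow> real) \<Rightarrow> 's pmf \<Rightarrow> ('s \<Rightarrow> 'a pmf) \<Rightarrow> 's \<Rightarrow> real \<Rightarrow> real" where
  "reward_EVaR_given p r ph \<pi> s \<alpha> =
     EVaR \<alpha> (cond_pmf (trajectory_pmf p ph \<pi>) {(t, a, s'). t = s}) (\<lambda>(t, a, s'). r s a s')"

text \<open>In both sets below, a summand with \<open>pmf \<xi> s = 0\<close> vanishes, as required by the convention
  \<open>0 log 0 = 0\<close>.\<close>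

definition Z'\<^sub>E :: "'s::finite pmf \<Rightarrow> real \<Rightarrow> ('s \<Rightarrow> real) \<Rightarrow> 's pmf set" where
  "Z'\<^sub>E ph \<alpha> \<zeta> =
     {\<xi>. (\<forall>s. pmf ph s = 0 \<longrightarrow> pmf \<xi> s = 0) \<and>
          (\<Sum>s\<in>UNIV. pmf \<xi> s * (ln (pmf \<xi> s / pmf ph s) - ln (\<zeta> s))) \<le> - ln \<alpha>}"

definition Z\<^sub>E :: "'s::finite pmf \<Rightarrow> real \<Rightarrow> 's pmf set" where
  "Z\<^sub>E ph \<alpha> =
     {\<xi>. (\<Sum>s\<in>UNIV. pmf \<xi> s * ln (pmf \<xi> s / pmf ph s)) \<le> - ln \<alpha> \<and>
          (\<forall>s. \<alpha> * pmf \<xi> s \<le> pmf ph s)}"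

end

theory Submission
  imports Defs "HOL-Real_Asymp.Real_Asymp"
begin

text \<open>On a finite space the entropic value at risk has the dual form
  \<open>EVaR \<alpha> M X = inf {E\<^sub>Q X | Q \<lless> M, KL(Q, M) \<le> - ln \<alpha>}\<close>: a budget of relative entropy may be spent
  on making \<open>X\<close> small. Split the probability space along the initial state. The law of total
  expectation writes \<open>E\<^sub>Q X\<close> as the average, under the law \<open>\<xi>\<close> of the state under \<open>Q\<close>, of the
  conditional expectations, and the chain rule splits \<open>KL(Q, M)\<close> into the entropy of \<open>\<xi>\<close> plus
  the \<open>\<xi>\<close>-average of the conditional entropies. Writing \<open>- ln (\<zeta> s)\<close> for the part of the budget
  spent in state \<open>s\<close>, minimising over the conditional laws first leaves the infimum over \<open>\<zeta>\<close>
  and \<open>\<xi>\<close> of the decomposition. The state may be replaced by any map \<open>f\<close> with finitely many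
  values (\<open>EVaR_decomposition\<close>).

  The inequality between the risk and the decomposed value needs only Gibbs' inequality
  (\<open>EVaR_le_decomposition\<close>). The other one rests on strong duality (\<open>EVaR_dual_approx\<close>), which
  is obtained from the exponential tilts of \<open>M\<close> and the intermediate value theorem.

  The upper bound over \<open>Z\<^sub>E\<close> comes from one admissible choice of \<open>\<zeta>\<close>, proportional to \<open>\<xi> / ph\<close>. Its
  minimum is attained because the objective is a supremum of continuous functions, hence lower
  semicontinuous, on a compact set (\<open>proportional_decomposition_attains_min\<close>).\<close>

section \<open>Relative entropy on a finite space\<close>

lemma pmf_exists_of_weights:
  fixes q :: "'w::finite \<Rightarrow> real"
  assumes nonneg: "\<And>w. 0 \<le> q w" and total: "(\<Sum>w\<in>UNIV. q w) = 1"
  obtains Q where "\<And>w. pmf Q w = q w"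
proof -
  have "(\<integral>\<^sup>+ w. ennreal (q w) \<partial>count_space UNIV) = 1"
    by (simp add: nn_integral_count_space_finite sum_ennreal nonneg total)
  then have "pmf (embed_pmf q) w = q w" for w
    by (intro pmf_embed_pmf nonneg)
  then show thesis
    by (rule that)
qed

lemma expectation_finite_type:
  fixes M :: "'w::finite pmf" and X :: "'w \<Rightarrow> real"
  shows "measure_pmf.expectation M X = (\<Sum>w\<in>UNIV. pmf M w * X w)"
  by (subst integral_measure_pmf_real[where A = UNIV]) (auto simp: mult.commute)

definition relative_entropy :: "'w::finite pmf \<Rightarrow> 'w pmf \<Rightarrow> real" where
  "relative_entropy Q M = (\<Sum>w\<in>UNIV. pmf Q w * ln (pmf Q w / pmf M w))"

lemma relative_entropy_self [simp]: "relative_entropy M M = 0"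
  unfolding relative_entropy_def
  by (rule sum.neutral) auto

text \<open>This is Gibbs' inequality for an unnormalised weight \<open>a\<close>: it follows from summing
  \<open>ln y \<le> y - 1\<close> at \<open>y = a w / (q w * \<Sum>a)\<close> with weights \<open>q w\<close>.\<close>

lemma sum_ln_ratio_le_ln_sum:
  fixes Q :: "'w::finite pmf" and a :: "'w \<Rightarrow> real"
  assumes nonneg: "\<And>w. 0 \<le> a w" and ac: "\<And>w. a w = 0 \<Longrightarrow> pmf Q w = 0"
  shows "(\<Sum>w\<in>UNIV. pmf Q w * ln (a w / pmf Q w)) \<le> ln (\<Sum>w\<in>UNIV. a w)"
proof -
  define Z where "Z = (\<Sum>w\<in>UNIV. a w)"
  have total: "(\<Sum>w\<in>UNIV. pmf Q w) = 1"
    by (simp add: sum_pmf_eq_1)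
  have "Z \<noteq> 0"
  proof
    assume "Z = 0"
    then have "a w = 0" for w
      unfolding Z_def using nonneg by (simp add: sum_nonneg_eq_0_iff)
    then show False
      using total ac by simp
  qed
  then have Z: "0 < Z"
    unfolding Z_def using nonneg by (simp add: order_less_le sum_nonneg)
  have "pmf Q w * ln (a w / pmf Q w) \<le> a w / Z - pmf Q w + pmf Q w * ln Z" for w
  proof (cases "pmf Q w = 0")
    case True
    then show ?thesis using nonneg Z by simp
  next
    case False
    then have q: "0 < pmf Q w" and aw: "0 < a w"
      using ac[of w] nonneg[of w] by (auto simp: order_less_le)
    have "ln (a w / pmf Q w) = ln (a w / (pmf Q w * Z)) + ln Z"
      using q aw Z by (simp add: ln_div ln_mult)
    also have "\<dots> \<le> a w / (pmf Q w * Z) - 1 + ln Z"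
      using q aw Z by (intro add_right_mono ln_le_minus_one) simp
    finally have "pmf Q w * ln (a w / pmf Q w) \<le> pmf Q w * (a w / (pmf Q w * Z) - 1 + ln Z)"
      by (intro mult_left_mono) auto
    also have "\<dots> = a w / Z - pmf Q w + pmf Q w * ln Z"
      using q Z by (simp add: field_simps)
    finally show ?thesis .
  qed
  then have "(\<Sum>w\<in>UNIV. pmf Q w * ln (a w / pmf Q w))
      \<le> (\<Sum>w\<in>UNIV. a w / Z - pmf Q w + pmf Q w * ln Z)"
    by (rule sum_mono)
  also have "\<dots> = (\<Sum>w\<in>UNIV. a w) / Z - 1 + ln Z"
    by (simp add: sum.distrib sum_subtractf total flip: sum_divide_distrib sum_distrib_right)
  also have "\<dots> = ln Z"
    using Z by (simp add: Z_def)
  finally show ?thesis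
    by (simp add: Z_def)
qed

lemma relative_entropy_nonneg:
  assumes "set_pmf Q \<subseteq> set_pmf M"
  shows "0 \<le> relative_entropy Q M"
proof -
  have ac: "pmf Q w = 0" if "pmf M w = 0" for w
    using assms that by (auto simp: set_pmf_eq)
  have "(\<Sum>w\<in>UNIV. pmf Q w * ln (pmf M w / pmf Q w)) \<le> 0"
    using sum_ln_ratio_le_ln_sum[of "pmf M" Q] ac by (simp add: sum_pmf_eq_1)
  moreover have "pmf Q w * ln (pmf M w / pmf Q w) = - (pmf Q w * ln (pmf Q w / pmf M w))" for w
    using ac[of w] by (cases "pmf Q w = 0"; cases "pmf M w = 0") (auto simp: ln_div algebra_simps)
  ultimately show ?thesis
    by (simp add: relative_entropy_def sum_negf)
qed

section \<open>Duality for the entropic value at risk\<close>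

definition laplace_transform :: "'w pmf \<Rightarrow> ('w \<Rightarrow> real) \<Rightarrow> real \<Rightarrow> real" where
  "laplace_transform M X \<beta> = measure_pmf.expectation M (\<lambda>w. exp (- \<beta> * X w))"

lemma laplace_transform_sum:
  fixes M :: "'w::finite pmf"
  shows "laplace_transform M X \<beta> = (\<Sum>w\<in>UNIV. pmf M w * exp (- \<beta> * X w))"
  by (simp add: laplace_transform_def expectation_finite_type)

lemma laplace_transform_pos:
  fixes M :: "'w::finite pmf"
  shows "0 < laplace_transform M X \<beta>"
proof -
  obtain w where "pmf M w \<noteq> 0"
    using set_pmf_not_empty[of M] by (auto simp: set_pmf_eq)
  then have "0 < pmf M w * exp (- \<beta> * X w)"
    by simp
  also have "\<dots> \<le> laplace_transform M X \<beta>"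
    unfolding laplace_transform_sum
    by (rule member_le_sum) auto
  finally show ?thesis .
qed

definition EVaR_bound :: "real \<Rightarrow> 'w pmf \<Rightarrow> ('w \<Rightarrow> real) \<Rightarrow> real \<Rightarrow> real" where
  "EVaR_bound \<alpha> M X \<beta> = - (1 / \<beta>) * ln (inverse \<alpha> * laplace_transform M X \<beta>)"

lemma EVaR_eq_Sup_EVaR_bound:
  "\<alpha> \<noteq> 0 \<Longrightarrow> EVaR \<alpha> M X = (SUP \<beta>\<in>{0<..}. EVaR_bound \<alpha> M X \<beta>)"
  by (simp add: EVaR_def EVaR_bound_def laplace_transform_def)

lemma EVaR_bound_eq:
  fixes M :: "'w::finite pmf"
  assumes "0 < \<alpha>"
  shows "EVaR_bound \<alpha> M X \<beta> = (ln \<alpha> - ln (laplace_transform M X \<beta>)) / \<beta>"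
  using assms laplace_transform_pos[of M X \<beta>]
  by (simp add: EVaR_bound_def ln_mult ln_inverse diff_divide_distrib right_diff_distrib)

text \<open>The Donsker--Varadhan inequality \<open>- \<beta> E\<^sub>Q X - KL(Q, M) \<le> ln E\<^sub>M exp (- \<beta> X)\<close>, rearranged.\<close>

lemma EVaR_bound_le_expectation:
  fixes M :: "'w::finite pmf"
  assumes \<alpha>: "0 < \<alpha>" and \<beta>: "0 < \<beta>" and ac: "set_pmf Q \<subseteq> set_pmf M"
    and entropy: "relative_entropy Q M \<le> - ln \<alpha>"
  shows "EVaR_bound \<alpha> M X \<beta> \<le> measure_pmf.expectation Q X"
proof -
  have ac': "pmf Q w = 0" if "pmf M w = 0" for w
    using ac that by (auto simp: set_pmf_eq)
  have summand: "pmf Q w * ln (pmf M w * exp (- \<beta> * X w) / pmf Q w)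
      = - \<beta> * (pmf Q w * X w) - pmf Q w * ln (pmf Q w / pmf M w)" for w
    using ac'[of w]
    by (cases "pmf Q w = 0"; cases "pmf M w = 0")
      (auto simp: ln_div ln_mult algebra_simps)
  have "(\<Sum>w\<in>UNIV. pmf Q w * ln (pmf M w * exp (- \<beta> * X w) / pmf Q w))
      = - \<beta> * measure_pmf.expectation Q X - relative_entropy Q M"
    unfolding summand sum_subtractf
    by (simp only: relative_entropy_def expectation_finite_type sum_distrib_left)
  moreover have "(\<Sum>w\<in>UNIV. pmf Q w * ln (pmf M w * exp (- \<beta> * X w) / pmf Q w))
      \<le> ln (laplace_transform M X \<beta>)"
    unfolding laplace_transform_sum
    by (rule sum_ln_ratio_le_ln_sum) (auto intro: ac')
  ultimately have "ln \<alpha> - ln (laplace_transform M X \<beta>) \<le> measure_pmf.expectation Q X * \<beta>"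
    using entropy by (simp add: algebra_simps)
  then show ?thesis
    using \<alpha> \<beta> by (simp add: EVaR_bound_eq pos_divide_le_eq)
qed

lemma EVaR_bound_le_EVaR:
  fixes M :: "'w::finite pmf"
  assumes "\<alpha> \<in> {0<..1}" and "0 < \<beta>"
  shows "EVaR_bound \<alpha> M X \<beta> \<le> EVaR \<alpha> M X"
proof -
  have "EVaR_bound \<alpha> M X b \<le> measure_pmf.expectation M X" if "0 < b" for b
    using assms that by (intro EVaR_bound_le_expectation) auto
  then have "bdd_above (EVaR_bound \<alpha> M X ` {0<..})"
    by (intro bdd_aboveI2) auto
  then show ?thesis
    using assms by (auto simp: EVaR_eq_Sup_EVaR_bound intro: cSUP_upper)
qed

lemma EVaR_leI:
  assumes "\<alpha> \<noteq> 0" and "\<And>\<beta>. 0 < \<beta> \<Longrightarrow> EVaR_bound \<alpha> M X \<beta> \<le> c"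
  shows "EVaR \<alpha> M X \<le> c"
  unfolding EVaR_eq_Sup_EVaR_bound[OF assms(1)]
  by (rule cSUP_least) (simp_all add: assms(2))

lemma EVaR_le_expectation:
  fixes M :: "'w::finite pmf"
  assumes "0 < \<alpha>" and "set_pmf Q \<subseteq> set_pmf M" and "relative_entropy Q M \<le> - ln \<alpha>"
  shows "EVaR \<alpha> M X \<le> measure_pmf.expectation Q X"
  using assms by (intro EVaR_leI EVaR_bound_le_expectation) auto

text \<open>The dual optimisers are found among the Gibbs measures \<open>Q \<propto> M exp (- \<beta> X)\<close>, where the
  Donsker--Varadhan inequality is an equality.\<close>

lemma gibbs_measure_exists:
  fixes M :: "'w::finite pmf" and X :: "'w \<Rightarrow> real"
  defines "m \<equiv> \<lambda>\<beta>. (\<Sum>w\<in>UNIV. pmf M w * exp (- \<beta> * X w) * X w) / laplace_transform M X \<beta>"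
  obtains Q where "set_pmf Q = set_pmf M" "measure_pmf.expectation Q X = m \<beta>"
    "relative_entropy Q M = - \<beta> * m \<beta> - ln (laplace_transform M X \<beta>)"
proof -
  let ?L = "laplace_transform M X \<beta>"
  note L = laplace_transform_pos[of M X \<beta>]
  obtain Q where Q: "\<And>w. pmf Q w = pmf M w * exp (- \<beta> * X w) / ?L"
  proof (rule pmf_exists_of_weights)
    show "(\<Sum>w\<in>UNIV. pmf M w * exp (- \<beta> * X w) / ?L) = 1"
      using L by (simp add: laplace_transform_sum flip: sum_divide_distrib)
  qed (use L in auto)
  have mean: "measure_pmf.expectation Q X = m \<beta>"
    by (simp add: expectation_finite_type m_def Q sum_divide_distrib)
  have "pmf Q w * ln (pmf Q w / pmf M w) = - \<beta> * (pmf Q w * X w) - ln ?L * pmf Q w" for w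
  proof (cases "pmf M w = 0")
    case False
    then have "pmf Q w / pmf M w = exp (- \<beta> * X w) / ?L"
      by (simp add: Q)
    then show ?thesis
      using L by (simp add: ln_div algebra_simps)
  qed (simp add: Q)
  then have "relative_entropy Q M = - \<beta> * measure_pmf.expectation Q X - ln ?L"
    unfolding relative_entropy_def expectation_finite_type
    by (simp only: sum_subtractf sum_pmf_eq_1 finite subset_UNIV mult_1_right flip: sum_distrib_left)
  then show thesis
    using that[of Q] mean L by (auto simp: Q set_pmf_eq)
qed

text \<open>Strong duality. The entropy \<open>D \<beta>\<close> of the Gibbs measure at \<open>\<beta>\<close> starts from \<open>D 0 = 0\<close>. If it
  reaches \<open>- ln \<alpha>\<close> at some \<open>\<beta> > 0\<close>, the mean there is exactly the value at \<open>\<beta>\<close> of the function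
  whose supremum is the \<open>EVaR\<close>. If it never does, the two differ by at most \<open>- ln \<alpha> / \<beta>\<close>, and
  \<open>\<beta>\<close> may be taken large. For \<open>\<alpha> = 1\<close> the optimiser is \<open>M\<close> itself, which is the Gibbs measure at
  \<open>\<beta> = 0\<close>, and the bound follows from those at \<open>\<beta> > 0\<close> in the limit.\<close>

lemma EVaR_dual_approx:
  fixes M :: "'w::finite pmf"
  assumes \<alpha>: "\<alpha> \<in> {0<..1}" and \<epsilon>: "0 < \<epsilon>"
  obtains Q where "set_pmf Q \<subseteq> set_pmf M" "relative_entropy Q M \<le> - ln \<alpha>"
    "measure_pmf.expectation Q X \<le> EVaR \<alpha> M X + \<epsilon>"
proof -
  let ?L = "laplace_transform M X"
  define m where "m = (\<lambda>\<beta>. (\<Sum>w\<in>UNIV. pmf M w * exp (- \<beta> * X w) * X w) / ?L \<beta>)"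
  define D where "D = (\<lambda>\<beta>. - \<beta> * m \<beta> - ln (?L \<beta>))"
  have L: "0 < ?L \<beta>" for \<beta>
    by (rule laplace_transform_pos)
  then have L0: "?L \<beta> \<noteq> 0" for \<beta>
    by (metis less_irrefl)
  have contL: "continuous_on UNIV ?L"
    unfolding laplace_transform_sum by (intro continuous_intros)
  have contm: "continuous_on UNIV m"
    unfolding m_def by (intro continuous_intros contL ballI L0)
  have contD: "continuous_on UNIV D"
    unfolding D_def using L0 by (intro continuous_intros contL contm) auto
  have gibbs: "\<exists>Q. set_pmf Q = set_pmf M \<and> measure_pmf.expectation Q X = m \<beta>
      \<and> relative_entropy Q M = D \<beta>" for \<beta>
    by (rule gibbs_measure_exists[of M X \<beta>]) (auto simp: m_def D_def)
  have D_nonneg: "0 \<le> D \<beta>" for \<beta>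
    using gibbs[of \<beta>] relative_entropy_nonneg[of _ M] by (metis order_refl)
  have gap: "m \<beta> = EVaR_bound \<alpha> M X \<beta> + (- ln \<alpha> - D \<beta>) / \<beta>" if "0 < \<beta>" for \<beta>
    using \<alpha> that by (simp add: EVaR_bound_eq D_def field_simps)
  have le_EVaR: "EVaR_bound \<alpha> M X \<beta> \<le> EVaR \<alpha> M X" if "0 < \<beta>" for \<beta>
    using \<alpha> that by (rule EVaR_bound_le_EVaR)
  have D0: "D 0 = 0"
    by (simp add: D_def laplace_transform_def)
  have "\<exists>\<beta>. D \<beta> \<le> - ln \<alpha> \<and> m \<beta> \<le> EVaR \<alpha> M X + \<epsilon>"
  proof (cases "\<alpha> = 1")
    case True
    have "m \<beta> \<le> EVaR \<alpha> M X" if "0 < \<beta>" for \<beta>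
      using gap[OF that] le_EVaR[OF that] divide_nonneg_pos[OF D_nonneg[of \<beta>] that] True
      by simp
    then have "eventually (\<lambda>\<beta>. m \<beta> \<le> EVaR \<alpha> M X) (at_right 0)"
      by (rule eventually_mono[OF eventually_at_right_less])
    moreover have "(m \<longlongrightarrow> m 0) (at_right 0)"
      using contm by (auto simp: continuous_on_def intro: tendsto_within_subset)
    ultimately have "m 0 \<le> EVaR \<alpha> M X"
      by (intro tendsto_upperbound) auto
    then show ?thesis
      using True \<epsilon> D0 by (intro exI[of _ 0]) auto
  next
    case False
    then have pos: "0 < - ln \<alpha>"
      using \<alpha> by auto
    show ?thesis
    proof (cases "\<exists>\<beta>>0. - ln \<alpha> \<le> D \<beta>")
      case True
      then obtain c where "0 < c" "- ln \<alpha> \<le> D c"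
        by blast
      then obtain b where b: "0 \<le> b" "D b = - ln \<alpha>"
        using IVT'[of D 0 "- ln \<alpha>" c] pos D0 continuous_on_subset[OF contD] by auto
      then have "0 < b"
        using D0 pos by (cases "b = 0") auto
      then show ?thesis
        using gap[of b] le_EVaR[of b] b \<epsilon> by (intro exI[of _ b]) auto
    next
      case False
      let ?b = "- ln \<alpha> / \<epsilon>"
      have b: "0 < ?b"
        using pos \<epsilon> by (rule divide_pos_pos)
      have "(- ln \<alpha> - D ?b) / ?b \<le> - ln \<alpha> / ?b"
        using b D_nonneg[of ?b] by (intro divide_right_mono) auto
      also have "\<dots> = \<epsilon>"
        using pos \<epsilon> by simp
      finally have "m ?b \<le> EVaR \<alpha> M X + \<epsilon>"
        unfolding gap[OF b] using le_EVaR[OF b] by linarith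
      moreover have "D ?b \<le> - ln \<alpha>"
        using False b by (meson le_cases)
      ultimately show ?thesis
        by blast
    qed
  qed
  then obtain \<beta> where \<beta>: "D \<beta> \<le> - ln \<alpha>" "m \<beta> \<le> EVaR \<alpha> M X + \<epsilon>"
    by blast
  obtain Q where "set_pmf Q = set_pmf M" "measure_pmf.expectation Q X = m \<beta>"
    "relative_entropy Q M = D \<beta>"
    using gibbs by blast
  then show thesis
    using that[of Q] \<beta> by simp
qed

section \<open>Conditioning on a finite-valued map\<close>

lemma pmf_map_eq_sum_fibre:
  fixes M :: "'w::finite pmf"
  shows "pmf (map_pmf f M) s = (\<Sum>w\<in>f -` {s}. pmf M w)"
  by (simp add: pmf_map measure_measure_pmf_finite)

lemma sum_fibres:
  fixes f :: "'w::finite \<Rightarrow> 's::finite" and g :: "'w \<Rightarrow> real"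
  shows "(\<Sum>s\<in>UNIV. \<Sum>w\<in>f -` {s}. g w) = (\<Sum>w\<in>UNIV. g w)"
  using sum.group[of UNIV UNIV f g] by (simp add: vimage_def)

lemma fibre_nonempty:
  assumes "pmf (map_pmf f M) s \<noteq> 0"
  shows "set_pmf M \<inter> f -` {s} \<noteq> {}"
proof -
  have "s \<in> set_pmf (map_pmf f M)"
    using assms by (simp add: set_pmf_eq)
  then show ?thesis
    by auto
qed

lemma pmf_cond_fibre:
  assumes "pmf (map_pmf f M) s \<noteq> 0"
  shows "pmf (cond_pmf M (f -` {s})) w
    = (if f w = s then pmf M w / pmf (map_pmf f M) s else 0)"
  by (simp add: pmf_cond[OF fibre_nonempty[OF assms]] pmf_map)

lemma pmf_mult_expectation_fibre:
  fixes M :: "'w::finite pmf"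
  assumes "pmf (map_pmf f M) s \<noteq> 0"
  shows "pmf (map_pmf f M) s * measure_pmf.expectation (cond_pmf M (f -` {s})) X
    = (\<Sum>w\<in>f -` {s}. pmf M w * X w)"
proof -
  have "measure_pmf.expectation (cond_pmf M (f -` {s})) X
      = (\<Sum>w\<in>f -` {s}. pmf M w / pmf (map_pmf f M) s * X w)"
    unfolding expectation_finite_type
    by (rule sum.mono_neutral_cong_right) (auto simp: pmf_cond_fibre[OF assms])
  then show ?thesis
    using assms by (simp add: sum_distrib_left)
qed

lemma law_of_total_expectation:
  fixes M :: "'w::finite pmf" and f :: "'w \<Rightarrow> 's::finite"
  shows "(\<Sum>s\<in>UNIV. pmf (map_pmf f M) s * measure_pmf.expectation (cond_pmf M (f -` {s})) X)
    = measure_pmf.expectation M X"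
proof -
  have "pmf (map_pmf f M) s * measure_pmf.expectation (cond_pmf M (f -` {s})) X
      = (\<Sum>w\<in>f -` {s}. pmf M w * X w)" for s
  proof (cases "pmf (map_pmf f M) s = 0")
    case True
    then have "pmf M w = 0" if "w \<in> f -` {s}" for w
      using that unfolding pmf_map_eq_sum_fibre by (simp add: sum_nonneg_eq_0_iff)
    then show ?thesis
      using True by simp
  qed (rule pmf_mult_expectation_fibre)
  then show ?thesis
    by (simp add: sum_fibres expectation_finite_type)
qed

text \<open>The chain rule for relative entropy: the density of \<open>Q\<close> with respect to \<open>M\<close> is the density
  of the images times the density of the conditional laws, and the logarithm turns this into
  a sum.\<close>

lemma relative_entropy_chain_rule:
  fixes M :: "'w::finite pmf" and f :: "'w \<Rightarrow> 's::finite"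
  assumes ac: "set_pmf Q \<subseteq> set_pmf M"
  shows "relative_entropy Q M =
    (\<Sum>s\<in>UNIV. pmf (map_pmf f Q) s * (ln (pmf (map_pmf f Q) s / pmf (map_pmf f M) s)
      + relative_entropy (cond_pmf Q (f -` {s})) (cond_pmf M (f -` {s}))))"
proof -
  have ac': "pmf Q w = 0" if "pmf M w = 0" for w
    using ac that by (auto simp: set_pmf_eq)
  have "(\<Sum>w\<in>f -` {s}. pmf Q w * ln (pmf Q w / pmf M w))
    = pmf (map_pmf f Q) s * (ln (pmf (map_pmf f Q) s / pmf (map_pmf f M) s)
      + relative_entropy (cond_pmf Q (f -` {s})) (cond_pmf M (f -` {s})))" for s
  proof (cases "pmf (map_pmf f Q) s = 0")
    case True
    then have "pmf Q w = 0" if "w \<in> f -` {s}" for w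
      using that unfolding pmf_map_eq_sum_fibre by (simp add: sum_nonneg_eq_0_iff)
    then show ?thesis
      using True by simp
  next
    case False
    let ?q = "pmf (map_pmf f Q) s" and ?p = "pmf (map_pmf f M) s"
    have "?p \<noteq> 0"
      using False ac by (auto simp: pmf_eq_0_set_pmf)
    then have p: "0 < ?p" and q: "0 < ?q"
      using False by (auto simp: pmf_pos)
    have "pmf Q w * ln (pmf Q w / pmf M w)
        = pmf Q w * (ln (?q / ?p) + ln (pmf Q w / ?q / (pmf M w / ?p)))" for w
    proof (cases "pmf Q w = 0")
      case False
      then have "0 < pmf Q w" "0 < pmf M w"
        using ac'[of w] by (auto simp: less_le)
      then show ?thesis
        using p q by (simp add: ln_div ln_mult)
    qed simp
    then have "(\<Sum>w\<in>f -` {s}. pmf Q w * ln (pmf Q w / pmf M w))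
      = ?q * ln (?q / ?p) + (\<Sum>w\<in>f -` {s}. pmf Q w * ln (pmf Q w / ?q / (pmf M w / ?p)))"
      by (simp add: distrib_left sum.distrib pmf_map_eq_sum_fibre[of f Q] sum_distrib_right)
    also have "(\<Sum>w\<in>f -` {s}. pmf Q w * ln (pmf Q w / ?q / (pmf M w / ?p)))
      = (\<Sum>w\<in>f -` {s}. ?q * (pmf Q w / ?q * ln (pmf Q w / ?q / (pmf M w / ?p))))"
      using q by (intro sum.cong) auto
    also have "\<dots> = ?q * relative_entropy (cond_pmf Q (f -` {s})) (cond_pmf M (f -` {s}))"
      unfolding relative_entropy_def sum_distrib_left
      by (rule sum.mono_neutral_cong_left)
        (auto simp: pmf_cond_fibre[OF False] pmf_cond_fibre[OF \<open>?p \<noteq> 0\<close>])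
    finally show ?thesis
      by (simp add: distrib_left)
  qed
  then show ?thesis
    unfolding relative_entropy_def[of Q M] by (simp flip: sum_fibres[of _ f])
qed

section \<open>Decomposition of the entropic value at risk\<close>

text \<open>For fixed \<open>\<beta>\<close> the Laplace transform of \<open>X\<close> is the mixture of the conditional ones, and
  Gibbs' inequality bounds the logarithm of the mixture below by any reweighting \<open>\<xi>\<close> of the
  conditional logarithms, at the price of an entropy that the budget \<open>- ln \<alpha>\<close> pays for.\<close>

lemma EVaR_le_decomposition:
  fixes M :: "'w::finite pmf" and f :: "'w \<Rightarrow> 's::finite"
  assumes \<alpha>: "\<alpha> \<in> {0<..1}" and \<zeta>: "\<And>s. \<zeta> s \<in> {0<..1}"
    and \<xi>: "\<xi> \<in> Z'\<^sub>E (map_pmf f M) \<alpha> \<zeta>"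
  shows "EVaR \<alpha> M X \<le> (\<Sum>s\<in>UNIV. pmf \<xi> s * EVaR (\<zeta> s) (cond_pmf M (f -` {s})) X)"
proof (rule EVaR_leI)
  show "\<alpha> \<noteq> 0"
    using \<alpha> by simp
next
  fix \<beta> :: real
  assume \<beta>: "0 < \<beta>"
  define p where "p = pmf (map_pmf f M)"
  define l where "l s = laplace_transform (cond_pmf M (f -` {s})) X \<beta>" for s
  have l: "0 < l s" for s
    unfolding l_def by (rule laplace_transform_pos)
  have ac: "pmf \<xi> s = 0" if "p s = 0" for s
    using \<xi> that by (auto simp: Z'\<^sub>E_def p_def)
  have budget: "(\<Sum>s\<in>UNIV. pmf \<xi> s * (ln (pmf \<xi> s / p s) - ln (\<zeta> s))) \<le> - ln \<alpha>"
    using \<xi> by (simp add: Z'\<^sub>E_def p_def)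
  have "(\<Sum>s\<in>UNIV. pmf \<xi> s * ln (p s * l s / pmf \<xi> s)) \<le> ln (\<Sum>s\<in>UNIV. p s * l s)"
  proof (rule sum_ln_ratio_le_ln_sum)
    show "0 \<le> p s * l s" for s
      using l[of s] by (simp add: p_def)
    show "pmf \<xi> s = 0" if "p s * l s = 0" for s
      using ac[of s] that l[of s] by auto
  qed
  also have "(\<Sum>s\<in>UNIV. p s * l s) = laplace_transform M X \<beta>"
    by (simp add: p_def l_def laplace_transform_def law_of_total_expectation)
  finally have gibbs:
    "(\<Sum>s\<in>UNIV. pmf \<xi> s * ln (p s * l s / pmf \<xi> s)) \<le> ln (laplace_transform M X \<beta>)" .
  have "pmf \<xi> s * ln (p s * l s / pmf \<xi> s)
      = pmf \<xi> s * (ln (l s) - ln (\<zeta> s)) - pmf \<xi> s * (ln (pmf \<xi> s / p s) - ln (\<zeta> s))" for s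
  proof (cases "pmf \<xi> s = 0")
    case False
    then have "0 < pmf \<xi> s" "0 < p s"
      using ac[of s] by (auto simp: p_def less_le)
    then show ?thesis
      using l[of s] by (simp add: ln_div ln_mult algebra_simps)
  qed simp
  then have "(\<Sum>s\<in>UNIV. pmf \<xi> s * ln (p s * l s / pmf \<xi> s))
      = (\<Sum>s\<in>UNIV. pmf \<xi> s * (ln (l s) - ln (\<zeta> s)))
        - (\<Sum>s\<in>UNIV. pmf \<xi> s * (ln (pmf \<xi> s / p s) - ln (\<zeta> s)))"
    by (simp add: sum_subtractf)
  with gibbs budget
  have "ln \<alpha> - ln (laplace_transform M X \<beta>) \<le> - (\<Sum>s\<in>UNIV. pmf \<xi> s * (ln (l s) - ln (\<zeta> s)))"
    by linarith
  also have "\<dots> = (\<Sum>s\<in>UNIV. pmf \<xi> s * (ln (\<zeta> s) - ln (l s)))"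
    by (simp add: algebra_simps flip: sum_negf)
  finally have "EVaR_bound \<alpha> M X \<beta> \<le> (\<Sum>s\<in>UNIV. pmf \<xi> s * (ln (\<zeta> s) - ln (l s))) / \<beta>"
    using \<alpha> \<beta> by (simp add: EVaR_bound_eq divide_right_mono)
  also have "\<dots> = (\<Sum>s\<in>UNIV. pmf \<xi> s * EVaR_bound (\<zeta> s) (cond_pmf M (f -` {s})) X \<beta>)"
    using \<zeta> by (simp add: EVaR_bound_eq l_def sum_divide_distrib)
  also have "\<dots> \<le> (\<Sum>s\<in>UNIV. pmf \<xi> s * EVaR (\<zeta> s) (cond_pmf M (f -` {s})) X)"
    using \<zeta> \<beta> by (intro sum_mono mult_left_mono EVaR_bound_le_EVaR) auto
  finally show "EVaR_bound \<alpha> M X \<beta>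
      \<le> (\<Sum>s\<in>UNIV. pmf \<xi> s * EVaR (\<zeta> s) (cond_pmf M (f -` {s})) X)" .
qed

text \<open>A nearly optimal \<open>Q\<close> for the dual problem yields nearly optimal parameters: \<open>\<xi>\<close> is the image
  of \<open>Q\<close>, and \<open>\<zeta> s\<close> is the level whose budget is exactly the entropy of the conditional law
  of \<open>Q\<close>. The chain rule says that these spend no more than the total budget.\<close>

lemma EVaR_decomposition_approx:
  fixes M :: "'w::finite pmf" and f :: "'w \<Rightarrow> 's::finite"
  assumes \<alpha>: "\<alpha> \<in> {0<..1}" and \<epsilon>: "0 < \<epsilon>"
  obtains \<zeta> \<xi> where "\<And>s. \<zeta> s \<in> {0<..1}" "\<xi> \<in> Z'\<^sub>E (map_pmf f M) \<alpha> \<zeta>"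
    "(\<Sum>s\<in>UNIV. pmf \<xi> s * EVaR (\<zeta> s) (cond_pmf M (f -` {s})) X) \<le> EVaR \<alpha> M X + \<epsilon>"
proof -
  obtain Q where ac: "set_pmf Q \<subseteq> set_pmf M" and entropy: "relative_entropy Q M \<le> - ln \<alpha>"
    and mean: "measure_pmf.expectation Q X \<le> EVaR \<alpha> M X + \<epsilon>"
    using EVaR_dual_approx[OF \<alpha> \<epsilon>] by blast
  define \<xi> where "\<xi> = map_pmf f Q"
  define K where "K s = relative_entropy (cond_pmf Q (f -` {s})) (cond_pmf M (f -` {s}))" for s
  define \<zeta> where "\<zeta> s = (if pmf \<xi> s = 0 then 1 else exp (- K s))" for s
  have cond_ac: "set_pmf (cond_pmf Q (f -` {s})) \<subseteq> set_pmf (cond_pmf M (f -` {s}))"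
    if "pmf \<xi> s \<noteq> 0" for s
  proof -
    have "set_pmf Q \<inter> f -` {s} \<noteq> {}"
      using that fibre_nonempty[of f Q s] by (simp add: \<xi>_def)
    moreover from this have "set_pmf M \<inter> f -` {s} \<noteq> {}"
      using ac by blast
    ultimately show ?thesis
      using ac by (auto simp: set_cond_pmf)
  qed
  have \<zeta>: "\<zeta> s \<in> {0<..1}" for s
    using cond_ac[of s] by (auto simp: \<zeta>_def K_def relative_entropy_nonneg)
  moreover have "\<xi> \<in> Z'\<^sub>E (map_pmf f M) \<alpha> \<zeta>"
  proof -
    have "pmf \<xi> s = 0" if "pmf (map_pmf f M) s = 0" for s
      using that ac by (auto simp: \<xi>_def pmf_eq_0_set_pmf)
    moreover have "(\<Sum>s\<in>UNIV. pmf \<xi> s * (ln (pmf \<xi> s / pmf (map_pmf f M) s) - ln (\<zeta> s)))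
        = relative_entropy Q M"
      unfolding relative_entropy_chain_rule[OF ac, of f] \<xi>_def[symmetric] K_def[symmetric]
      by (intro sum.cong) (auto simp: \<zeta>_def)
    ultimately show ?thesis
      using entropy by (simp add: Z'\<^sub>E_def)
  qed
  moreover have "(\<Sum>s\<in>UNIV. pmf \<xi> s * EVaR (\<zeta> s) (cond_pmf M (f -` {s})) X)
      \<le> EVaR \<alpha> M X + \<epsilon>"
  proof -
    have "pmf \<xi> s * EVaR (\<zeta> s) (cond_pmf M (f -` {s})) X
        \<le> pmf \<xi> s * measure_pmf.expectation (cond_pmf Q (f -` {s})) X" for s
    proof (cases "pmf \<xi> s = 0")
      case False
      then have "EVaR (\<zeta> s) (cond_pmf M (f -` {s})) X
          \<le> measure_pmf.expectation (cond_pmf Q (f -` {s})) X"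
        by (intro EVaR_le_expectation cond_ac) (auto simp: \<zeta>_def K_def)
      then show ?thesis
        by (simp add: mult_left_mono)
    qed simp
    then have "(\<Sum>s\<in>UNIV. pmf \<xi> s * EVaR (\<zeta> s) (cond_pmf M (f -` {s})) X)
        \<le> (\<Sum>s\<in>UNIV. pmf \<xi> s * measure_pmf.expectation (cond_pmf Q (f -` {s})) X)"
      by (rule sum_mono)
    also have "\<dots> = measure_pmf.expectation Q X"
      by (simp add: \<xi>_def law_of_total_expectation)
    finally show ?thesis
      using mean by simp
  qed
  ultimately show thesis
    by (rule that)
qed

theorem EVaR_decomposition:
  fixes M :: "'w::finite pmf" and f :: "'w \<Rightarrow> 's::finite"
  assumes \<alpha>: "\<alpha> \<in> {0<..1}"
  shows "EVaR \<alpha> M X =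
    Inf {\<Sum>s\<in>UNIV. pmf \<xi> s * EVaR (\<zeta> s) (cond_pmf M (f -` {s})) X | \<zeta> \<xi>.
      (\<forall>s. \<zeta> s \<in> {0<..1}) \<and> \<xi> \<in> Z'\<^sub>E (map_pmf f M) \<alpha> \<zeta>}"
    (is "_ = Inf ?V")
proof (rule antisym)
  have lower: "EVaR \<alpha> M X \<le> v" if "v \<in> ?V" for v
    using that by (clarify, intro EVaR_le_decomposition[OF \<alpha>]) auto
  obtain \<zeta> \<xi> where "\<And>s. \<zeta> s \<in> {0<..1}" "\<xi> \<in> Z'\<^sub>E (map_pmf f M) \<alpha> \<zeta>"
    using EVaR_decomposition_approx[OF \<alpha> zero_less_one] by metis
  then have "?V \<noteq> {}"
    by blast
  then show "EVaR \<alpha> M X \<le> Inf ?V"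
    by (rule cInf_greatest) (rule lower)
  have bdd: "bdd_below ?V"
    by (rule bdd_belowI) (rule lower)
  show "Inf ?V \<le> EVaR \<alpha> M X"
  proof (rule field_le_epsilon)
    fix \<epsilon> :: real
    assume "0 < \<epsilon>"
    then obtain \<zeta> \<xi> where "\<And>s. \<zeta> s \<in> {0<..1}" "\<xi> \<in> Z'\<^sub>E (map_pmf f M) \<alpha> \<zeta>"
      and le: "(\<Sum>s\<in>UNIV. pmf \<xi> s * EVaR (\<zeta> s) (cond_pmf M (f -` {s})) X) \<le> EVaR \<alpha> M X + \<epsilon>"
      by (rule EVaR_decomposition_approx[OF \<alpha>, where M = M and f = f and X = X]) blast
    then have "(\<Sum>s\<in>UNIV. pmf \<xi> s * EVaR (\<zeta> s) (cond_pmf M (f -` {s})) X) \<in> ?V"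
      by blast
    then show "Inf ?V \<le> EVaR \<alpha> M X + \<epsilon>"
      using le by (rule cInf_lower2[OF _ _ bdd])
  qed
qed

text \<open>The choice \<open>\<zeta> s = \<alpha> \<xi> s / p s\<close> spends the budget exactly. Where \<open>\<xi> s = 0\<close> this is the level \<open>0\<close>, which \<open>\<zeta>\<close> may not take; there any other level serves, since the summand
  vanishes.\<close>

lemma EVaR_le_proportional_decomposition:
  fixes M :: "'w::finite pmf" and f :: "'w \<Rightarrow> 's::finite"
  assumes pos: "\<And>s. 0 < pmf (map_pmf f M) s" and \<alpha>: "\<alpha> \<in> {0<..1}"
    and \<xi>: "\<xi> \<in> Z\<^sub>E (map_pmf f M) \<alpha>"
  shows "EVaR \<alpha> M X \<le> (\<Sum>s\<in>UNIV. pmf \<xi> s *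
    EVaR (\<alpha> * pmf \<xi> s * inverse (pmf (map_pmf f M) s)) (cond_pmf M (f -` {s})) X)"
proof -
  let ?p = "pmf (map_pmf f M)"
  define \<zeta> where "\<zeta> s = (if pmf \<xi> s = 0 then 1 else \<alpha> * pmf \<xi> s * inverse (?p s))" for s
  have "\<zeta> s \<in> {0<..1}" for s
    using \<xi> \<alpha> pos[of s]
    by (auto simp: \<zeta>_def Z\<^sub>E_def pmf_pos field_simps)
  moreover have "\<xi> \<in> Z'\<^sub>E (map_pmf f M) \<alpha> \<zeta>"
  proof -
    have "pmf \<xi> s * (ln (pmf \<xi> s / ?p s) - ln (\<zeta> s)) = - ln \<alpha> * pmf \<xi> s" for s
      using \<alpha> pos[of s]
      by (cases "pmf \<xi> s = 0") (auto simp: \<zeta>_def ln_div ln_mult ln_inverse pmf_pos)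
    then have "(\<Sum>s\<in>UNIV. pmf \<xi> s * (ln (pmf \<xi> s / ?p s) - ln (\<zeta> s))) = - ln \<alpha>"
      by (simp add: sum_pmf_eq_1 sum_negf flip: sum_distrib_left)
    then show ?thesis
      using pos by (auto simp: Z'\<^sub>E_def) (metis less_irrefl)
  qed
  ultimately have "EVaR \<alpha> M X \<le> (\<Sum>s\<in>UNIV. pmf \<xi> s * EVaR (\<zeta> s) (cond_pmf M (f -` {s})) X)"
    using \<alpha> by (intro EVaR_le_decomposition)
  also have "\<dots> = (\<Sum>s\<in>UNIV. pmf \<xi> s *
      EVaR (\<alpha> * pmf \<xi> s * inverse (?p s)) (cond_pmf M (f -` {s})) X)"
    by (intro sum.cong) (auto simp: \<zeta>_def)
  finally show ?thesis .
qed

section \<open>Attainment of the minimum\<close>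

text \<open>A pointwise supremum of continuous functions is lower semicontinuous: its sublevel sets are
  intersections of closed ones, and by compactness they all meet.\<close>

lemma sup_of_continuous_attains_min:
  fixes F :: "'a::t2_space \<Rightarrow> real" and H :: "'b \<Rightarrow> 'a \<Rightarrow> real"
  assumes K: "compact K" "K \<noteq> {}"
    and cont: "\<And>b. b \<in> B \<Longrightarrow> continuous_on K (H b)"
    and sup: "\<And>x c. x \<in> K \<Longrightarrow> F x \<le> c \<longleftrightarrow> (\<forall>b\<in>B. H b x \<le> c)"
  obtains x where "x \<in> K" "\<And>y. y \<in> K \<Longrightarrow> F x \<le> F y"
proof -
  define C where "C y = K \<inter> (\<Inter>b\<in>B. {x\<in>K. H b x \<le> F y})" for y
  have C: "x \<in> C y \<longleftrightarrow> x \<in> K \<and> F x \<le> F y" for x y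
    using sup by (auto simp: C_def)
  have "K \<inter> \<Inter> (C ` K) \<noteq> {}"
  proof (rule compact_imp_fip[OF K(1)])
    fix T
    assume "T \<in> C ` K"
    then show "closed T"
      using cont K(1)
      by (auto simp: C_def compact_imp_closed intro!: closed_Int closed_INT
          continuous_on_closed_Collect_le continuous_on_const)
  next
    fix T
    assume "finite T" "T \<subseteq> C ` K"
    then obtain Y where Y: "finite Y" "Y \<subseteq> K" "T = C ` Y"
      by (meson finite_subset_image)
    show "K \<inter> \<Inter> T \<noteq> {}"
    proof (cases "Y = {}")
      case False
      then have "arg_min_on F Y \<in> Y" "\<And>y. y \<in> Y \<Longrightarrow> F (arg_min_on F Y) \<le> F y"
        using Y by (auto intro: arg_min_if_finite(1) arg_min_least)
      then show ?thesis
        using Y C by blast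
    qed (use K Y in auto)
  qed
  then obtain x where "x \<in> K" "\<And>y. y \<in> K \<Longrightarrow> x \<in> C y"
    by blast
  then show thesis
    using that[of x] by (simp add: C)
qed

lemma continuous_on_x_ln_x: "continuous_on {0..} (\<lambda>x::real. x * ln x)"
proof -
  have "((\<lambda>x::real. x * ln x) \<longlongrightarrow> 0) (at_right 0)"
    by real_asymp
  then have "((\<lambda>x::real. x * ln x) \<longlongrightarrow> 0) (at 0 within {0..})"
    by (simp add: at_within_Ici_at_right)
  then have "continuous (at 0 within {0..}) (\<lambda>x::real. x * ln x)"
    by (simp add: continuous_within)
  moreover have "continuous (at x within {0..}) (\<lambda>x::real. x * ln x)" if "0 < x" for x
  proof (rule continuous_at_imp_continuous_at_within)
    show "isCont (\<lambda>x::real. x * ln x) x"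
      using that by (intro continuous_intros) auto
  qed
  ultimately show ?thesis
    unfolding continuous_on_eq_continuous_within by (metis atLeast_iff order_le_less)
qed

lemma continuous_on_x_ln_c_x:
  fixes c :: real
  assumes "0 < c"
  shows "continuous_on {0..} (\<lambda>x. x * ln (c * x))"
proof -
  have "continuous_on {0..} (\<lambda>x::real. x * ln x + x * ln c)"
    by (intro continuous_intros continuous_on_x_ln_x)
  moreover have "x * ln x + x * ln c = x * ln (c * x)" if "0 \<le> x" for x
    using that assms by (cases "x = 0") (auto simp: ln_mult algebra_simps)
  ultimately show ?thesis
    by (metis (no_types, lifting) atLeast_iff continuous_on_cong)
qed

text \<open>Here \<open>x EVaR (c x)\<close> is, as a function of \<open>x\<close>, a supremum of functions that are continuous down
  to \<open>x = 0\<close> because \<open>x ln x\<close> is; so the objective is a supremum of continuous functions, indexed by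
  one \<open>\<beta>\<close> for each point of the index set.\<close>

lemma proportional_decomposition_attains_min:
  fixes N :: "'s::finite \<Rightarrow> 'w::finite pmf" and ph :: "'s pmf"
  assumes pos: "\<And>s. 0 < pmf ph s" and \<alpha>: "\<alpha> \<in> {0<..1}"
  shows "\<exists>\<xi>\<^sub>0. is_arg_min
    (\<lambda>\<xi>. \<Sum>s\<in>UNIV. pmf \<xi> s * EVaR (\<alpha> * pmf \<xi> s * inverse (pmf ph s)) (N s) X)
    (\<lambda>\<xi>. \<xi> \<in> Z\<^sub>E ph \<alpha>) \<xi>\<^sub>0"
proof -
  define c where "c s = \<alpha> * inverse (pmf ph s)" for s
  have c: "0 < c s" for s
    using pos \<alpha> by (simp add: c_def)
  define F where "F v = (\<Sum>s\<in>UNIV. v $ s * EVaR (c s * v $ s) (N s) X)" for v :: "real ^ 's"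
  define H where "H b v = (\<Sum>s\<in>UNIV. v $ s * EVaR_bound (c s * v $ s) (N s) X (b s))"
    for b and v :: "real ^ 's"
  define K where "K = {v :: real ^ 's. (\<forall>s. 0 \<le> v $ s) \<and> (\<Sum>s\<in>UNIV. v $ s) = 1 \<and>
    (\<Sum>s\<in>UNIV. v $ s * ln (inverse (pmf ph s) * v $ s)) \<le> - ln \<alpha> \<and> (\<forall>s. \<alpha> * v $ s \<le> pmf ph s)}"
  have Z_iff: "\<xi> \<in> Z\<^sub>E ph \<alpha> \<longleftrightarrow> (\<chi> s. pmf \<xi> s) \<in> K" for \<xi>
    by (simp add: Z\<^sub>E_def K_def sum_pmf_eq_1 divide_inverse mult.commute)
  have K_nonneg: "0 \<le> v $ s" if "v \<in> K" for v s
    using that by (simp add: K_def)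
  have K_level: "c s * v $ s \<in> {0<..1}" if "v \<in> K" "v $ s \<noteq> 0" for v s
  proof -
    have "\<alpha> * v $ s \<le> pmf ph s" "0 < v $ s"
      using that K_nonneg[of v s] by (auto simp: K_def less_le)
    then show ?thesis
      using pos[of s] \<alpha> by (simp add: c_def field_simps)
  qed
  have compact: "compact K"
  proof -
    define P where "P = {v :: real ^ 's. \<forall>s. 0 \<le> v $ s}"
    have P: "closed P"
      unfolding P_def by (intro closed_Collect_all closed_Collect_le continuous_intros)
    have entropy: "continuous_on P (\<lambda>v. \<Sum>s\<in>UNIV. v $ s * ln (inverse (pmf ph s) * v $ s))"
    proof (rule continuous_on_sum)
      fix s
      show "continuous_on P (\<lambda>v. v $ s * ln (inverse (pmf ph s) * v $ s))"
        by (rule continuous_on_compose2[OF continuous_on_x_ln_c_x])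
          (auto simp: P_def pos intro!: continuous_intros)
    qed
    have "K = {v\<in>P. (\<Sum>s\<in>UNIV. v $ s * ln (inverse (pmf ph s) * v $ s)) \<le> - ln \<alpha>}
        \<inter> {v. (\<Sum>s\<in>UNIV. v $ s) = 1} \<inter> {v. \<forall>s. \<alpha> * v $ s \<le> pmf ph s}"
      by (auto simp: K_def P_def)
    also have "closed \<dots>"
      by (intro closed_Int continuous_on_closed_Collect_le entropy P closed_Collect_eq
          closed_Collect_all closed_Collect_le continuous_intros)
    finally have "closed K" .
    moreover have "bounded K"
    proof (rule boundedI)
      fix v
      assume v: "v \<in> K"
      have "norm v \<le> (\<Sum>s\<in>UNIV. \<bar>v $ s\<bar>)"
        by (rule norm_le_l1_cart)
      also have "\<dots> = 1"
        using v by (simp add: K_def)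
      finally show "norm v \<le> 1" .
    qed
    ultimately show ?thesis
      by (simp add: compact_eq_bounded_closed)
  qed
  have nonempty: "K \<noteq> {}"
  proof -
    have "ph \<in> Z\<^sub>E ph \<alpha>"
      using \<alpha> unfolding Z\<^sub>E_def relative_entropy_def[symmetric]
      by (auto simp: mult_left_le_one_le)
    then show ?thesis
      by (auto simp: Z_iff)
  qed
  have cont: "continuous_on K (H b)" if "b \<in> {b. \<forall>s. 0 < b s}" for b
    unfolding H_def
  proof (rule continuous_on_sum)
    fix s
    let ?l = "ln (laplace_transform (N s) X (b s))"
    have "continuous_on K (\<lambda>v. v $ s * ln (c s * v $ s))"
      by (rule continuous_on_compose2[OF continuous_on_x_ln_c_x[OF c]])
        (auto simp: K_nonneg intro!: continuous_intros)
    moreover have "continuous_on K (\<lambda>v. v $ s * ?l)"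
      by (intro continuous_intros)
    ultimately have "continuous_on K (\<lambda>v. v $ s * ln (c s * v $ s) - v $ s * ?l)"
      by (rule continuous_on_diff)
    moreover have "b s \<noteq> 0"
      using that by (metis less_irrefl mem_Collect_eq)
    ultimately have "continuous_on K (\<lambda>v. (v $ s * ln (c s * v $ s) - v $ s * ?l) / b s)"
      by (intro continuous_on_divide continuous_on_const) auto
    moreover have "(v $ s * ln (c s * v $ s) - v $ s * ?l) / b s
        = v $ s * EVaR_bound (c s * v $ s) (N s) X (b s)" if "v \<in> K" for v
      using K_level[OF that] by (cases "v $ s = 0") (auto simp: EVaR_bound_eq algebra_simps)
    ultimately show "continuous_on K (\<lambda>v. v $ s * EVaR_bound (c s * v $ s) (N s) X (b s))"
      by (metis (no_types, lifting) continuous_on_cong)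
  qed
  have sup: "F v \<le> d \<longleftrightarrow> (\<forall>b\<in>{b. \<forall>s. 0 < b s}. H b v \<le> d)" if v: "v \<in> K" for v d
  proof (intro iffI ballI)
    fix b :: "'s \<Rightarrow> real"
    assume "F v \<le> d" "b \<in> {b. \<forall>s. 0 < b s}"
    moreover from this have "v $ s * EVaR_bound (c s * v $ s) (N s) X (b s)
        \<le> v $ s * EVaR (c s * v $ s) (N s) X" for s
      using K_level[OF v] K_nonneg[OF v]
      by (cases "v $ s = 0") (auto intro!: mult_left_mono EVaR_bound_le_EVaR)
    then have "H b v \<le> F v"
      unfolding H_def F_def by (rule sum_mono)
    ultimately show "H b v \<le> d"
      by simp
  next
    assume le: "\<forall>b\<in>{b. \<forall>s. 0 < b s}. H b v \<le> d"
    show "F v \<le> d"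
    proof (rule field_le_epsilon)
      fix e :: real
      assume e: "0 < e"
      \<comment> \<open>The components of \<open>b\<close> can be chosen independently, each nearly optimal for its own \<open>s\<close>,
        and the errors \<open>v $ s * e\<close> add up to \<open>e\<close>.\<close>
      have "\<exists>\<beta>>0. v $ s * EVaR (c s * v $ s) (N s) X
          \<le> v $ s * EVaR_bound (c s * v $ s) (N s) X \<beta> + v $ s * e" for s
      proof (cases "v $ s = 0")
        case False
        have "\<not> EVaR (c s * v $ s) (N s) X \<le> EVaR (c s * v $ s) (N s) X - e"
          using e by simp
        then obtain \<beta> where "0 < \<beta>"
          "EVaR (c s * v $ s) (N s) X \<le> EVaR_bound (c s * v $ s) (N s) X \<beta> + e"
          using EVaR_leI[of "c s * v $ s" "N s" X "EVaR (c s * v $ s) (N s) X - e"]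
            K_level[OF v False] by force
        then show ?thesis
          using K_nonneg[OF v, of s] by (auto simp flip: distrib_left intro: mult_left_mono)
      qed (auto intro: exI[of _ 1])
      then obtain b where b: "\<And>s. 0 < b s"
        "\<And>s. v $ s * EVaR (c s * v $ s) (N s) X
          \<le> v $ s * EVaR_bound (c s * v $ s) (N s) X (b s) + v $ s * e"
        by metis
      have "F v \<le> (\<Sum>s\<in>UNIV. v $ s * EVaR_bound (c s * v $ s) (N s) X (b s) + v $ s * e)"
        unfolding F_def by (intro sum_mono b)
      also have "\<dots> = H b v + e"
        using v by (simp add: H_def K_def sum.distrib flip: sum_distrib_right)
      also have "\<dots> \<le> d + e"
        using le b by simp
      finally show "F v \<le> d + e" .
    qed
  qed
  obtain v where v: "v \<in> K" and v_min: "\<And>u. u \<in> K \<Longrightarrow> F v \<le> F u"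
    using sup_of_continuous_attains_min[OF compact nonempty cont sup] by blast
  obtain \<xi>\<^sub>0 where \<xi>\<^sub>0: "\<And>s. pmf \<xi>\<^sub>0 s = v $ s"
    using pmf_exists_of_weights[of "\<lambda>s. v $ s"] v by (auto simp: K_def)
  have F_pmf: "(\<Sum>s\<in>UNIV. pmf \<xi> s * EVaR (\<alpha> * pmf \<xi> s * inverse (pmf ph s)) (N s) X)
      = F (\<chi> s. pmf \<xi> s)" for \<xi>
    by (simp add: F_def c_def mult_ac)
  have "(\<chi> s. pmf \<xi>\<^sub>0 s) = v"
    by (simp add: \<xi>\<^sub>0 vec_eq_iff)
  then show ?thesis
    unfolding is_arg_min_linorder F_pmf Z_iff using v v_min by metis
qed

section \<open>One-step Markov decision processes\<close>

lemma map_fst_trajectory_pmf: "map_pmf fst (trajectory_pmf p ph \<pi>) = ph"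
  by (simp add: trajectory_pmf_def map_bind_pmf bind_return_pmf')

lemma EVaR_cong:
  assumes "\<And>w. w \<in> set_pmf M \<Longrightarrow> X w = Y w"
  shows "EVaR \<alpha> M X = EVaR \<alpha> M Y"
proof -
  have "(AE w in measure_pmf M. c \<le> X w) \<longleftrightarrow> (AE w in measure_pmf M. c \<le> Y w)" for c
    using assms by (simp add: AE_measure_pmf_iff)
  moreover have "measure_pmf.expectation M (\<lambda>w. exp (- \<beta> * X w))
      = measure_pmf.expectation M (\<lambda>w. exp (- \<beta> * Y w))" for \<beta>
    using assms by (intro integral_cong_AE) (auto simp: AE_measure_pmf_iff)
  ultimately show ?thesis
    by (simp add: EVaR_def ess_inf_def)
qed

lemma reward_EVaR_given_fibre:
  assumes "pmf ph s \<noteq> 0"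
  shows "reward_EVaR_given p r ph \<pi> s \<alpha> =
    EVaR \<alpha> (cond_pmf (trajectory_pmf p ph \<pi>) (fst -` {s})) (\<lambda>(s, a, s'). r s a s')"
proof -
  have fibre: "{(t, a, s'). t = s} = fst -` {s}"
    by auto
  have "set_pmf (trajectory_pmf p ph \<pi>) \<inter> fst -` {s} \<noteq> {}"
    using assms by (intro fibre_nonempty) (simp add: map_fst_trajectory_pmf)
  then show ?thesis
    unfolding reward_EVaR_given_def fibre by (intro EVaR_cong) (auto simp: set_cond_pmf)
qed

theorem theorem4p2:
  fixes p :: "'s::finite \<Rightarrow> 'a::finite \<Rightarrow> 's pmf"
    and r :: "'s \<Rightarrow> 'a \<Rightarrow> 's \<Rightarrow> real"
    and ph :: "'s pmf"
    and \<pi> :: "'s \<Rightarrow> 'a pmf"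
    and \<alpha> :: real
  assumes "\<forall>s. pmf ph s > 0"
    and "\<alpha> \<in> {0<..1}"
  shows "reward_EVaR p r ph \<pi> \<alpha> =
           Inf {\<Sum>s\<in>UNIV. pmf \<xi> s * reward_EVaR_given p r ph \<pi> s (\<zeta> s) | \<zeta> \<xi>.
                  (\<forall>s. \<zeta> s \<in> {0<..1}) \<and> \<xi> \<in> Z'\<^sub>E ph \<alpha> \<zeta>}
       \<and> (\<exists>\<xi>\<^sub>0. is_arg_min
                (\<lambda>\<xi>. \<Sum>s\<in>UNIV. pmf \<xi> s * reward_EVaR_given p r ph \<pi> s (\<alpha> * pmf \<xi> s * inverse (pmf ph s)))
                (\<lambda>\<xi>. \<xi> \<in> Z\<^sub>E ph \<alpha>) \<xi>\<^sub>0
            \<and> reward_EVaR p r ph \<pi> \<alpha> \<le>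
                (\<Sum>s\<in>UNIV. pmf \<xi>\<^sub>0 s * reward_EVaR_given p r ph \<pi> s (\<alpha> * pmf \<xi>\<^sub>0 s * inverse (pmf ph s))))"
proof
  let ?M = "trajectory_pmf p ph \<pi>" and ?X = "\<lambda>(s, a, s'). r s a s'"
  have given: "reward_EVaR_given p r ph \<pi> s \<zeta> = EVaR \<zeta> (cond_pmf ?M (fst -` {s})) ?X" for s \<zeta>
    using assms(1) by (intro reward_EVaR_given_fibre) (metis less_irrefl)
  show "reward_EVaR p r ph \<pi> \<alpha> =
      Inf {\<Sum>s\<in>UNIV. pmf \<xi> s * reward_EVaR_given p r ph \<pi> s (\<zeta> s) | \<zeta> \<xi>.
        (\<forall>s. \<zeta> s \<in> {0<..1}) \<and> \<xi> \<in> Z'\<^sub>E ph \<alpha> \<zeta>}"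
    using EVaR_decomposition[OF assms(2), of ?M ?X fst]
    by (simp only: reward_EVaR_def given map_fst_trajectory_pmf)
  obtain \<xi>\<^sub>0 where min: "is_arg_min
      (\<lambda>\<xi>. \<Sum>s\<in>UNIV. pmf \<xi> s * reward_EVaR_given p r ph \<pi> s (\<alpha> * pmf \<xi> s * inverse (pmf ph s)))
      (\<lambda>\<xi>. \<xi> \<in> Z\<^sub>E ph \<alpha>) \<xi>\<^sub>0"
    unfolding given using assms
    proportional_decomposition_attains_min[of ph \<alpha> "\<lambda>s. cond_pmf ?M (fst -` {s})" ?X] by blast
  then have "\<xi>\<^sub>0 \<in> Z\<^sub>E ph \<alpha>"
    by (simp add: is_arg_min_def)
  then have "reward_EVaR p r ph \<pi> \<alpha> \<le>
      (\<Sum>s\<in>UNIV. pmf \<xi>\<^sub>0 s * reward_EVaR_given p r ph \<pi> s (\<alpha> * pmf \<xi>\<^sub>0 s * inverse (pmf ph s)))"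
    using EVaR_le_proportional_decomposition[of fst ?M \<alpha> \<xi>\<^sub>0 ?X] assms
    by (simp only: reward_EVaR_def given map_fst_trajectory_pmf)
  with min show "\<exists>\<xi>\<^sub>0. is_arg_min
      (\<lambda>\<xi>. \<Sum>s\<in>UNIV. pmf \<xi> s * reward_EVaR_given p r ph \<pi> s (\<alpha> * pmf \<xi> s * inverse (pmf ph s)))
      (\<lambda>\<xi>. \<xi> \<in> Z\<^sub>E ph \<alpha>) \<xi>\<^sub>0
    \<and> reward_EVaR p r ph \<pi> \<alpha> \<le>
      (\<Sum>s\<in>UNIV. pmf \<xi>\<^sub>0 s * reward_EVaR_given p r ph \<pi> s (\<alpha> * pmf \<xi>\<^sub>0 s * inverse (pmf ph s)))"
    by blast
qed

end
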